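(* Provided with a consistent heuristic $h(\cdot)$, the algorithm ASEC is $\epsilon$-sound. That is, for every planning problem with edge cost estimation $\mathcal{P}=(\Sigma,\Theta_\Sigma,s_0,S_g)$ and every target $\epsilon\ge1$, whenever ASEC, run on $(\mathcal{P},\epsilon)$ with a consistent heuristic, returns a plan $\pi$ together with a bound $\eta_{eff}\le\epsilon$ (i.e. reports $\pi$ as $\epsilon$-optimal), the plan $\pi$ is a solution with $c(\pi)\le\epsilon\, c^*$.
   Context: **Planning domain.** A planning domain is a tuple $\Sigma=(S,A,\gamma,c)$, where $S$ is a finite set of states, $A$ is a finite set of actions, $\gamma$ is the state-transition function and $c$ is a nonnegative action cost function, finite for applicable actions. The digraph $\mathcal{G}_\Sigma$ has vertex set $S$ and edge set $\mathcal{E}$ consisting of all $e=(s,\gamma(s,a))$ with $a$ applicable in $s$. The edge cost is $c(e)=c(a)$. **Cost estimators.** A set of cost estimators is $\Theta_\Sigma=\{\Theta(e):e\in\mathcal{E}\}$, where $\Theta(e)=\{\theta^e_1,\dots,\theta^e_{k(e)}\}$ is finite and nonempty. Each $\theta_i^e$ returns numbers $c_{min}(\theta_i^e)\le c(e)\le c_{max}(\theta_i^e)$, and if $0<c(e)<\infty$ then $c_{min}(\theta_i^e)>0$ and $c_{max}(\theta_i^e)<\infty$. Lower bounds are nonnegative. When several estimators of one edge have been applied, the tightest bounds found so far are kept. Each estimator has finite running time. **Planning problem with edge cost estimation.** This is a tuple $(\Sigma,\Theta_\Sigma,s_0,S_g)$ with $s_0\in S$ and $S_g\subset S$, where $c$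 is unknown to the planner. A solution is a plan (finite action sequence) $\pi$ whose sequential application from $s_0$ ends in $S_g$. Its cost $c(\pi)$ is the sum of the true action costs, and $c^*$ is the minimum of $c(\pi)$ over all solutions. **Heuristic.** $h$ is a parameterized heuristic: each edge cost function $\alpha\ge0$ gives a function $h_\alpha$ on nodes. It is consistent if, for every $\alpha$, $h_\alpha(n)\le\alpha((n,s))+h_\alpha(s)$ for all edges $(n,s)$ and $h_\alpha=0$ on goal nodes. ASEC uses $h=h_\alpha$, where $\alpha(e)$ is the lower bound given by the first estimator that $\mathsf{GetEstimator}(e)$ returns. **Algorithm ASEC.** $\mathsf{GetEstimator}(e)$ returns an estimator from $\Theta(e)$ not yet applied (in an arbitrary but fixed order), or $\emptyset$ if none is left. Any ratio of an upper bound to a lower bound is taken to be $1$ when the lower bound is $0$. 1. Set $g_{min}(s_0)=g_{max}(s_0)=0$. OPEN and CLOSED are empty. Insert $s_0$ into OPEN with $f(s_0)=h(s_0)$. 2. While OPEN is nonempty: remove from OPEN a node $n$ of minimal $f$-value. If $n\in S_g$, return the plan obtained by tracing parents from $n$ back to $s_0$, together with $\eta_{eff}=g_{max}(n)/g_{min}(n)$. Otherwise insert $n$ into CLOSED and, for each successor $s$ of $n$, do the following. - (a) If $s\notin$ OPEN $\cup$ CLOSED, set $g_{min}(s)=\infty$. - (b) Set $\eta_{eff}=\infty$, $\underline g=0$, $\theta=\mathsf{GetEstimator}((n,s))$. - (c) While $\eta_{eff}>\epsilon$ and $\underline g<g_{min}(s)$ and $\theta\ne\emptyset$: apply $\theta$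 to obtain the (tightest so far) bounds $\underline c,\bar c$ of edge $(n,s)$; set $\underline g=g_{min}(n)+\underline c$, $\bar g=g_{max}(n)+\bar c$, $\eta_{eff}=\bar g/\underline g$, $\theta=\mathsf{GetEstimator}((n,s))$. - (d) If $\underline g<g_{min}(s)$: set $g_{min}(s)=\underline g$, $g_{max}(s)=\bar g$, make $n$ the parent of $s$, remove $s$ from OPEN and CLOSED if present, and insert $s$ into OPEN with $f(s)=g_{min}(s)+h(s)$. 3. If OPEN becomes empty, return $(\emptyset,\infty)$ (no plan). *)

theory Defs
  imports "HOL-Library.Extended_Real"
begin

section \<open>Planning domains and plans\<close>

record ('s, 'a) planning_domain =
  states :: "'s set"
  actions :: "'a set"
  trans :: "'s \<Rightarrow> 'a \<Rightarrow> 's option"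
  acost :: "'a \<Rightarrow> ereal"

definition applicable :: "('s, 'a) planning_domain \<Rightarrow> 's \<Rightarrow> 'a \<Rightarrow> bool" where
  "applicable \<Sigma> s a \<longleftrightarrow> s \<in> states \<Sigma> \<and> a \<in> actions \<Sigma> \<and> trans \<Sigma> s a \<noteq> None"

definition wf_domain :: "('s, 'a) planning_domain \<Rightarrow> bool" where
  "wf_domain \<Sigma> \<longleftrightarrow>
     finite (states \<Sigma>) \<and> finite (actions \<Sigma>) \<and>
     (\<forall>s a s'. applicable \<Sigma> s a \<and> trans \<Sigma> s a = Some s' \<longrightarrow> s' \<in> states \<Sigma>) \<and>
     (\<forall>a\<in>actions \<Sigma>. 0 \<le> acost \<Sigma> a) \<and>
     (\<forall>s a. applicable \<Sigma> s a \<longrightarrow> acost \<Sigma> a < \<infinity>)"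

definition edges :: "('s, 'a) planning_domain \<Rightarrow> ('s \<times> 's) set" where
  "edges \<Sigma> = {(s, s'). \<exists>a. applicable \<Sigma> s a \<and> trans \<Sigma> s a = Some s'}"

text \<open>
  The cost of an edge is the cost of an action inducing it. Several actions may induce the same
  edge; if all of them have the same cost, then \<open>edge_costs \<Sigma> e\<close> is the singleton \<open>{c(e)}\<close>.
  Conditions on \<open>c(e)\<close> are imposed below on every member of this set, so that equality of the
  costs of parallel actions need not be assumed.
\<close>

definition edge_costs :: "('s, 'a) planning_domain \<Rightarrow> 's \<times> 's \<Rightarrow> ereal set" where
  "edge_costs \<Sigma> e =
     {acost \<Sigma> a |a. applicable \<Sigma> (fst e) a \<and> trans \<Sigma> (fst e) a = Some (snd e)}"

fun exec :: "('s, 'a) planning_domain \<Rightarrow> 's \<Rightarrow> 'a list \<Rightarrow> 's option" where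
  "exec \<Sigma> s [] = Some s"
| "exec \<Sigma> s (a # \<pi>) =
     (if applicable \<Sigma> s a then exec \<Sigma> (the (trans \<Sigma> s a)) \<pi> else None)"

definition plan_cost :: "('s, 'a) planning_domain \<Rightarrow> 'a list \<Rightarrow> ereal" where
  "plan_cost \<Sigma> \<pi> = sum_list (map (acost \<Sigma>) \<pi>)"

section \<open>Planning problems with edge cost estimation\<close>

record ('s, 'a, 't) planning_problem =
  problem_domain :: "('s, 'a) planning_domain"
  estimators :: "'s \<times> 's \<Rightarrow> 't set"
  cmin :: "'t \<Rightarrow> ereal"
  cmax :: "'t \<Rightarrow> ereal"
  initial_state :: 's
  goals :: "'s set"

definition wf_estimators :: "('s, 'a, 't) planning_problem \<Rightarrow> bool" where
  "wf_estimators P \<longleftrightarrow>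
     (\<forall>e\<in>edges (problem_domain P).
        finite (estimators P e) \<and> estimators P e \<noteq> {} \<and>
        (\<forall>\<theta>\<in>estimators P e. 0 \<le> cmin P \<theta> \<and>
           (\<forall>c\<in>edge_costs (problem_domain P) e.
              cmin P \<theta> \<le> c \<and> c \<le> cmax P \<theta> \<and>
              (0 < c \<and> c < \<infinity> \<longrightarrow> 0 < cmin P \<theta> \<and> cmax P \<theta> < \<infinity>))))"

definition wf_problem :: "('s, 'a, 't) planning_problem \<Rightarrow> bool" where
  "wf_problem P \<longleftrightarrow>
     wf_domain (problem_domain P) \<and> wf_estimators P \<and>
     initial_state P \<in> states (problem_domain P) \<and> goals P \<subseteq> states (problem_domain P)"

definition is_solution :: "('s, 'a, 't) planning_problem \<Rightarrow> 'a list \<Rightarrow> bool" where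
  "is_solution P \<pi> \<longleftrightarrow>
     (\<exists>s\<in>goals P. exec (problem_domain P) (initial_state P) \<pi> = Some s)"

text \<open>
  The infimum is a minimum whenever a solution exists, because the state space is finite and
  costs are nonnegative.
\<close>

definition optimal_cost :: "('s, 'a, 't) planning_problem \<Rightarrow> ereal" where
  "optimal_cost P = (INF \<pi>\<in>{\<pi>. is_solution P \<pi>}. plan_cost (problem_domain P) \<pi>)"

section \<open>Parameterized heuristics\<close>

type_synonym 's heuristic = "('s \<times> 's \<Rightarrow> ereal) \<Rightarrow> 's \<Rightarrow> ereal"

definition edge_cost_function ::
    "('s, 'a) planning_domain \<Rightarrow> ('s \<times> 's \<Rightarrow> ereal) \<Rightarrow> bool" where
  "edge_cost_function \<Sigma> \<alpha> \<longleftrightarrow> (\<forall>e\<in>edges \<Sigma>. 0 \<le> \<alpha> e \<and> \<alpha> e < \<infinity>)"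

text \<open>
  Heuristic values are real or \<open>\<infinity>\<close> (dead ends); they are not required to be nonnegative.
\<close>

definition wf_heuristic :: "('s, 'a) planning_domain \<Rightarrow> 's heuristic \<Rightarrow> bool" where
  "wf_heuristic \<Sigma> h \<longleftrightarrow>
     (\<forall>\<alpha>. edge_cost_function \<Sigma> \<alpha> \<longrightarrow> (\<forall>s\<in>states \<Sigma>. h \<alpha> s \<noteq> -\<infinity>))"

definition consistent :: "('s, 'a) planning_domain \<Rightarrow> 's set \<Rightarrow> 's heuristic \<Rightarrow> bool" where
  "consistent \<Sigma> G h \<longleftrightarrow>
     (\<forall>\<alpha>. edge_cost_function \<Sigma> \<alpha> \<longrightarrow>
        (\<forall>(n, s)\<in>edges \<Sigma>. h \<alpha> n \<le> \<alpha> (n, s) + h \<alpha> s) \<and> (\<forall>s\<in>G. h \<alpha> s = 0))"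

section \<open>The algorithm ASEC\<close>

text \<open>
  The argument \<open>ord\<close> is the fixed order in which the estimators of each edge are tried. The
  algorithm never inspects the action costs.
\<close>

definition estimator_order ::
    "('s, 'a, 't) planning_problem \<Rightarrow> ('s \<times> 's \<Rightarrow> 't list) \<Rightarrow> bool" where
  "estimator_order P ord \<longleftrightarrow>
     (\<forall>e\<in>edges (problem_domain P). distinct (ord e) \<and> set (ord e) = estimators P e)"

definition get_estimator ::
    "('s \<times> 's \<Rightarrow> 't list) \<Rightarrow> ('s \<times> 's \<Rightarrow> 't set) \<Rightarrow> 's \<times> 's \<Rightarrow> 't option" where
  "get_estimator ord applied e = List.find (\<lambda>\<theta>. \<theta> \<notin> applied e) (ord e)"

definition lower_bound ::
    "('s, 'a, 't) planning_problem \<Rightarrow> ('s \<times> 's \<Rightarrow> 't set) \<Rightarrow> 's \<times> 's \<Rightarrow> ereal" where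
  "lower_bound P applied e = Max (cmin P ` applied e)"

definition upper_bound ::
    "('s, 'a, 't) planning_problem \<Rightarrow> ('s \<times> 's \<Rightarrow> 't set) \<Rightarrow> 's \<times> 's \<Rightarrow> ereal" where
  "upper_bound P applied e = Min (cmax P ` applied e)"

definition first_lower_bound ::
    "('s, 'a, 't) planning_problem \<Rightarrow> ('s \<times> 's \<Rightarrow> 't list) \<Rightarrow> 's \<times> 's \<Rightarrow> ereal" where
  "first_lower_bound P ord e = cmin P (the (get_estimator ord (\<lambda>_. {}) e))"

definition bound_ratio :: "ereal \<Rightarrow> ereal \<Rightarrow> ereal" where
  "bound_ratio u l = (if l = 0 then 1 else u / l)"

record ('s, 't) asec_state =
  OPEN :: "'s set"
  CLOSED :: "'s set"
  gmin :: "'s \<Rightarrow> ereal"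
  gmax :: "'s \<Rightarrow> ereal"
  fval :: "'s \<Rightarrow> ereal"
  parent :: "'s \<Rightarrow> 's option"
  applied_est :: "'s \<times> 's \<Rightarrow> 't set"

text \<open>
  The estimation loop for edge \<open>e = (n, s)\<close>, where \<open>gl\<close>, \<open>gu\<close> are the lower and upper bounds
  stored for \<open>n\<close> and \<open>gs\<close> is the lower bound stored for \<open>s\<close>. A configuration consists of
  \<open>\<eta>\<^sub>e\<^sub>f\<^sub>f\<close>, the current bounds on the cost of reaching \<open>s\<close> via \<open>n\<close>, and the estimators applied
  so far.
\<close>

inductive estimate ::
    "('s, 'a, 't) planning_problem \<Rightarrow> ('s \<times> 's \<Rightarrow> 't list) \<Rightarrow> real \<Rightarrow> 's \<times> 's \<Rightarrow>
     ereal \<Rightarrow> ereal \<Rightarrow> ereal \<Rightarrow>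
     ereal \<times> ereal \<times> ereal \<times> ('s \<times> 's \<Rightarrow> 't set) \<Rightarrow>
     ereal \<times> ereal \<times> ereal \<times> ('s \<times> 's \<Rightarrow> 't set) \<Rightarrow> bool"
  for P ord \<epsilon> e gl gu gs where
  stop: "\<not> (ereal \<epsilon> < \<eta> \<and> lo < gs \<and> get_estimator ord ap e \<noteq> None) \<Longrightarrow>
    estimate P ord \<epsilon> e gl gu gs (\<eta>, lo, up, ap) (\<eta>, lo, up, ap)"
| apply_est: "\<lbrakk>ereal \<epsilon> < \<eta>; lo < gs; get_estimator ord ap e = Some \<theta>;
    ap' = ap(e := insert \<theta> (ap e));
    lo' = gl + lower_bound P ap' e; up' = gu + upper_bound P ap' e;
    estimate P ord \<epsilon> e gl gu gs (bound_ratio up' lo', lo', up', ap') r\<rbrakk> \<Longrightarrow>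
    estimate P ord \<epsilon> e gl gu gs (\<eta>, lo, up, ap) r"

text \<open>
  Steps (a) to (d) for one successor. The upper bound \<open>up\<^sub>0\<close> held before the loop is arbitrary,
  since the pseudocode does not initialize it. The function \<open>hv\<close> is \<open>h\<^sub>\<alpha>\<close>.
\<close>

inductive process_successor ::
    "('s, 'a, 't) planning_problem \<Rightarrow> ('s \<times> 's \<Rightarrow> 't list) \<Rightarrow> real \<Rightarrow> ('s \<Rightarrow> ereal) \<Rightarrow> 's \<Rightarrow>
     's \<Rightarrow> ('s, 't) asec_state \<Rightarrow> ('s, 't) asec_state \<Rightarrow> bool"
  for P ord \<epsilon> hv n where
  "\<lbrakk>\<sigma>\<^sub>1 = (if s \<in> OPEN \<sigma> \<union> CLOSED \<sigma> then \<sigma> else \<sigma>\<lparr>gmin := (gmin \<sigma>)(s := \<infinity>)\<rparr>);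
    estimate P ord \<epsilon> (n, s) (gmin \<sigma>\<^sub>1 n) (gmax \<sigma>\<^sub>1 n) (gmin \<sigma>\<^sub>1 s)
      (\<infinity>, 0, up\<^sub>0, applied_est \<sigma>\<^sub>1) (\<eta>, lo, up, ap);
    \<sigma>\<^sub>2 = \<sigma>\<^sub>1\<lparr>applied_est := ap\<rparr>;
    \<sigma>' = (if lo < gmin \<sigma>\<^sub>1 s
          then \<sigma>\<^sub>2\<lparr>gmin := (gmin \<sigma>\<^sub>2)(s := lo), gmax := (gmax \<sigma>\<^sub>2)(s := up),
                  parent := (parent \<sigma>\<^sub>2)(s := Some n),
                  OPEN := insert s (OPEN \<sigma>\<^sub>2), CLOSED := CLOSED \<sigma>\<^sub>2 - {s},
                  fval := (fval \<sigma>\<^sub>2)(s := lo + hv s)\<rparr>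
          else \<sigma>\<^sub>2)\<rbrakk> \<Longrightarrow>
    process_successor P ord \<epsilon> hv n s \<sigma> \<sigma>'"

inductive process_successors ::
    "('s, 'a, 't) planning_problem \<Rightarrow> ('s \<times> 's \<Rightarrow> 't list) \<Rightarrow> real \<Rightarrow> ('s \<Rightarrow> ereal) \<Rightarrow> 's \<Rightarrow>
     's list \<Rightarrow> ('s, 't) asec_state \<Rightarrow> ('s, 't) asec_state \<Rightarrow> bool"
  for P ord \<epsilon> hv n where
  Nil: "process_successors P ord \<epsilon> hv n [] \<sigma> \<sigma>"
| Cons: "\<lbrakk>process_successor P ord \<epsilon> hv n s \<sigma> \<sigma>'; process_successors P ord \<epsilon> hv n ss \<sigma>' \<sigma>''\<rbrakk> \<Longrightarrow>
    process_successors P ord \<epsilon> hv n (s # ss) \<sigma> \<sigma>''"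

definition asec_initial ::
    "('s, 'a, 't) planning_problem \<Rightarrow> ('s \<Rightarrow> ereal) \<Rightarrow> ('s, 't) asec_state \<Rightarrow> bool" where
  "asec_initial P hv \<sigma> \<longleftrightarrow>
     OPEN \<sigma> = {initial_state P} \<and> CLOSED \<sigma> = {} \<and>
     gmin \<sigma> (initial_state P) = 0 \<and> gmax \<sigma> (initial_state P) = 0 \<and>
     fval \<sigma> (initial_state P) = hv (initial_state P) \<and>
     parent \<sigma> = (\<lambda>_. None) \<and> applied_est \<sigma> = (\<lambda>_. {})"

definition min_open :: "('s, 't) asec_state \<Rightarrow> 's \<Rightarrow> bool" where
  "min_open \<sigma> n \<longleftrightarrow> n \<in> OPEN \<sigma> \<and> (\<forall>m\<in>OPEN \<sigma>. fval \<sigma> n \<le> fval \<sigma> m)"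

inductive asec_step ::
    "('s, 'a, 't) planning_problem \<Rightarrow> ('s \<times> 's \<Rightarrow> 't list) \<Rightarrow> real \<Rightarrow> ('s \<Rightarrow> ereal) \<Rightarrow>
     ('s, 't) asec_state \<Rightarrow> ('s, 't) asec_state \<Rightarrow> bool"
  for P ord \<epsilon> hv where
  "\<lbrakk>min_open \<sigma> n; n \<notin> goals P;
    distinct ss; set ss = {s. (n, s) \<in> edges (problem_domain P)};
    process_successors P ord \<epsilon> hv n ss
      (\<sigma>\<lparr>OPEN := OPEN \<sigma> - {n}, CLOSED := insert n (CLOSED \<sigma>)\<rparr>) \<sigma>'\<rbrakk> \<Longrightarrow>
    asec_step P ord \<epsilon> hv \<sigma> \<sigma>'"

inductive traced_plan ::
    "('s, 'a, 't) planning_problem \<Rightarrow> ('s \<Rightarrow> 's option) \<Rightarrow> 's \<Rightarrow> 'a list \<Rightarrow> bool"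
  for P par where
  start: "traced_plan P par (initial_state P) []"
| extend: "\<lbrakk>s \<noteq> initial_state P; par s = Some n; traced_plan P par n \<pi>;
    applicable (problem_domain P) n a; trans (problem_domain P) n a = Some s\<rbrakk> \<Longrightarrow>
    traced_plan P par s (\<pi> @ [a])"

text \<open>
  \<open>asec P ord h \<epsilon> (r, \<eta>)\<close>: some run of ASEC on \<open>(P, \<epsilon>)\<close> returns \<open>(r, \<eta>)\<close>. The relation leaves
  open the choice among nodes of minimal \<open>f\<close>-value, the order of the successors, and the choice
  among parallel actions in the traced plan.
\<close>

inductive asec ::
    "('s, 'a, 't) planning_problem \<Rightarrow> ('s \<times> 's \<Rightarrow> 't list) \<Rightarrow> 's heuristic \<Rightarrow> real \<Rightarrow>
     'a list option \<times> ereal \<Rightarrow> bool"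
  for P ord h \<epsilon> where
  found: "\<lbrakk>hv = h (first_lower_bound P ord); asec_initial P hv \<sigma>\<^sub>0;
    (asec_step P ord \<epsilon> hv)\<^sup>*\<^sup>* \<sigma>\<^sub>0 \<sigma>;
    min_open \<sigma> n; n \<in> goals P; traced_plan P (parent \<sigma>) n \<pi>\<rbrakk> \<Longrightarrow>
    asec P ord h \<epsilon> (Some \<pi>, bound_ratio (gmax \<sigma> n) (gmin \<sigma> n))"
| no_plan: "\<lbrakk>hv = h (first_lower_bound P ord); asec_initial P hv \<sigma>\<^sub>0;
    (asec_step P ord \<epsilon> hv)\<^sup>*\<^sup>* \<sigma>\<^sub>0 \<sigma>; OPEN \<sigma> = {}\<rbrakk> \<Longrightarrow>
    asec P ord h \<epsilon> (None, \<infinity>)"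

end

theory Submission
  imports Defs
begin

text \<open>
  The first lower bound of an edge is at most every bound used later, so a consistent heuristic
  makes the \<open>f\<close>-values of selected nodes nondecreasing. Hence, as long as no node with infinite
  heuristic value is selected, a closed node is never reopened and every edge is estimated at most
  once. Then \<open>gmax\<close> bounds the cost of the traced plan from above, and the usual \<open>A\<^sup>*\<close> argument (every
  solution meets \<open>OPEN\<close>, with a prefix at least as costly as \<open>gmin\<close>) shows that \<open>gmin\<close> of a
  selected goal is at most the optimal cost. If \<open>gmin\<close> vanishes, all edges of the traced plan
  have true cost 0.
\<close>

section \<open>Edge costs, cost estimators and the estimation loop\<close>

locale estimation_problem =
  fixes P :: "('s, 'a, 't) planning_problem"
    and ord :: "'s \<times> 's \<Rightarrow> 't list"
    and \<epsilon> :: real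
  assumes wf: "wf_problem P"
    and ord: "estimator_order P ord"
begin

abbreviation "\<Sigma> \<equiv> problem_domain P"
abbreviation "\<alpha> \<equiv> first_lower_bound P ord"

lemma edge_states: "(n, s) \<in> edges \<Sigma> \<Longrightarrow> n \<in> states \<Sigma> \<and> s \<in> states \<Sigma>"
  using wf by (auto simp: wf_problem_def wf_domain_def edges_def applicable_def)

lemma edge_costs_bounds: "c \<in> edge_costs \<Sigma> e \<Longrightarrow> 0 \<le> c \<and> c < \<infinity>"
proof -
  assume "c \<in> edge_costs \<Sigma> e"
  then obtain a where a: "applicable \<Sigma> (fst e) a" "c = acost \<Sigma> a"
    by (auto simp: edge_costs_def)
  then have "a \<in> actions \<Sigma>" by (simp add: applicable_def)
  then show ?thesis using a wf unfolding wf_problem_def wf_domain_def by blast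
qed

lemma edge_costs_nonempty: "e \<in> edges \<Sigma> \<Longrightarrow> edge_costs \<Sigma> e \<noteq> {}"
  by (auto simp: edges_def edge_costs_def)

lemma applicable_edge:
  assumes "applicable \<Sigma> n a" "trans \<Sigma> n a = Some s"
  shows "(n, s) \<in> edges \<Sigma>" "acost \<Sigma> a \<in> edge_costs \<Sigma> (n, s)"
  using assms by (auto simp: edges_def edge_costs_def)

lemma estimators_finite: "e \<in> edges \<Sigma> \<Longrightarrow> finite (estimators P e)"
  and estimators_nonempty: "e \<in> edges \<Sigma> \<Longrightarrow> estimators P e \<noteq> {}"
  and cmin_nonneg: "e \<in> edges \<Sigma> \<Longrightarrow> \<theta> \<in> estimators P e \<Longrightarrow> 0 \<le> cmin P \<theta>"
  using wf by (auto simp: wf_problem_def wf_estimators_def)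

text \<open>A positive finite cost forces \<open>cmin P \<theta>\<close> to be positive, and edge
  costs are finite and nonnegative; the third claim is the contrapositive. It feeds the case of a
  zero lower bound, where the ratio carries no information.\<close>

lemma estimator_bounds:
  assumes "e \<in> edges \<Sigma>" "\<theta> \<in> estimators P e" "c \<in> edge_costs \<Sigma> e"
  shows "cmin P \<theta> \<le> c" "c \<le> cmax P \<theta>" "cmin P \<theta> = 0 \<Longrightarrow> c = 0"
proof -
  have "cmin P \<theta> \<le> c \<and> c \<le> cmax P \<theta> \<and> (0 < c \<and> c < \<infinity> \<longrightarrow> 0 < cmin P \<theta>)"
    using wf assms unfolding wf_problem_def wf_estimators_def by blast
  then show "cmin P \<theta> \<le> c" "c \<le> cmax P \<theta>" "cmin P \<theta> = 0 \<Longrightarrow> c = 0"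
    using edge_costs_bounds[OF assms(3)] by (auto simp: order_le_less)
qed

lemma get_estimator_in:
  assumes "e \<in> edges \<Sigma>" "get_estimator ord ap e = Some \<theta>"
  shows "\<theta> \<in> estimators P e"
proof -
  have "\<theta> \<in> set (ord e)" using assms(2) by (auto simp: get_estimator_def find_Some_iff)
  then show ?thesis using assms(1) ord by (simp add: estimator_order_def)
qed

text \<open>Ties the heuristic to the loop: on an edge that is still unestimated, the loop starts
  with the very estimator that defines \<open>\<alpha>\<close>.\<close>

lemma first_estimator:
  assumes "e \<in> edges \<Sigma>" "ap e = {}"
  obtains \<theta> where "get_estimator ord ap e = Some \<theta>" "\<theta> \<in> estimators P e" "\<alpha> e = cmin P \<theta>"
proof -
  have "set (ord e) \<noteq> {}"
    using ord estimators_nonempty assms(1) by (auto simp: estimator_order_def)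
  then obtain \<theta> ts where o: "ord e = \<theta> # ts" by (cases "ord e") auto
  have "get_estimator ord ap e = Some \<theta>" using o assms(2) by (simp add: get_estimator_def)
  moreover have "\<alpha> e = cmin P \<theta>" using o by (simp add: get_estimator_def first_lower_bound_def)
  ultimately show ?thesis using that get_estimator_in[OF assms(1)] by blast
qed

text \<open>Makes \<open>\<alpha>\<close> an edge cost function, so that consistency of the
  heuristic may be used at it. Finiteness holds because every edge has a cost, which is
  finite.\<close>

lemma first_lower_bound_bounds:
  assumes "e \<in> edges \<Sigma>"
  shows "0 \<le> \<alpha> e" "c \<in> edge_costs \<Sigma> e \<Longrightarrow> \<alpha> e \<le> c" "\<alpha> e < \<infinity>"
proof -
  obtain \<theta> where t: "\<theta> \<in> estimators P e" "\<alpha> e = cmin P \<theta>"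
    using first_estimator[OF assms, of "\<lambda>_. {}"] by blast
  show "0 \<le> \<alpha> e" using t cmin_nonneg assms by simp
  show le: "\<alpha> e \<le> c" if "c \<in> edge_costs \<Sigma> e" for c using t estimator_bounds assms that by simp
  obtain c where "c \<in> edge_costs \<Sigma> e" using edge_costs_nonempty assms by blast
  then show "\<alpha> e < \<infinity>" using le edge_costs_bounds le_less_trans by blast
qed

text \<open>Every applied estimator is valid, hence so are the extremes over them. For the last
  claim, the maximum is attained, so a zero maximum is the \<open>cmin\<close> of an applied
  estimator.\<close>

lemma tightest_bounds:
  assumes e: "e \<in> edges \<Sigma>" and ap: "ap e \<subseteq> estimators P e" "\<theta> \<in> ap e"
  shows "cmin P \<theta> \<le> lower_bound P ap e"
    and "c \<in> edge_costs \<Sigma> e \<Longrightarrow> lower_bound P ap e \<le> c"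
    and "c \<in> edge_costs \<Sigma> e \<Longrightarrow> c \<le> upper_bound P ap e"
    and "c \<in> edge_costs \<Sigma> e \<Longrightarrow> lower_bound P ap e = 0 \<Longrightarrow> c = 0"
proof -
  have fin: "finite (ap e)" using ap estimators_finite[OF e] finite_subset by blast
  have ne: "ap e \<noteq> {}" using ap by blast
  show "cmin P \<theta> \<le> lower_bound P ap e" using fin ap by (simp add: lower_bound_def)
  assume c: "c \<in> edge_costs \<Sigma> e"
  show "lower_bound P ap e \<le> c"
    using fin ne ap(1) estimator_bounds(1)[OF e _ c] by (auto simp: lower_bound_def)
  show "c \<le> upper_bound P ap e"
    using fin ne ap(1) estimator_bounds(2)[OF e _ c] by (auto simp: upper_bound_def)
  have "lower_bound P ap e \<in> cmin P ` ap e"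
    unfolding lower_bound_def using fin ap by (intro Max_in) auto
  then show "c = 0" if "lower_bound P ap e = 0"
    using that ap estimator_bounds(3)[OF e _ c] by fastforce
qed

text \<open>Loop invariant from the first application on. Tracking one applied
  \<open>\<theta>\<close> allows the final lower bound to be compared with \<open>\<alpha>\<close>
  when \<open>\<theta>\<close> is the first estimator.\<close>

lemma estimate_bounds_aux:
  assumes "estimate P ord \<epsilon> e gl gu gs (\<eta>, lo, up, ap) (\<eta>', lo', up', ap')"
    and "e \<in> edges \<Sigma>"
    and "ap e \<subseteq> estimators P e" "\<theta> \<in> ap e"
    and "lo = gl + lower_bound P ap e" "up = gu + upper_bound P ap e"
  shows "ap' e \<subseteq> estimators P e \<and> \<theta> \<in> ap' e \<and> (\<forall>e'. e' \<noteq> e \<longrightarrow> ap' e' = ap e') \<and>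
    lo' = gl + lower_bound P ap' e \<and> up' = gu + upper_bound P ap' e"
  using assms
proof (induction "(\<eta>, lo, up, ap)" "(\<eta>', lo', up', ap')" arbitrary: \<eta> lo up ap rule: estimate.induct)
  case stop
  then show ?case by simp
next
  case (apply_est \<eta> lo ap \<theta>' ap1 lo1 up1 up)
  have "\<theta>' \<in> estimators P e" using apply_est get_estimator_in by blast
  then have "ap1 e \<subseteq> estimators P e" "\<theta> \<in> ap1 e" using apply_est by auto
  then show ?case using apply_est by auto
qed

text \<open>
  The hypothesis \<open>ap e = {}\<close> is essential: if all estimators of \<open>e\<close> had been applied before,
  the loop would leave the meaningless bounds \<open>lo = 0\<close> and \<open>up = up\<^sub>0\<close>.
\<close>

lemma estimate_fresh:
  assumes est: "estimate P ord \<epsilon> e gl gu gs (\<infinity>, 0, up\<^sub>0, ap) (\<eta>, lo, up, ap')"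
    and e: "e \<in> edges \<Sigma>" and ap: "ap e = {}" and gl: "0 \<le> gl" "gl < \<infinity>"
  shows "\<And>e'. e' \<noteq> e \<Longrightarrow> ap' e' = ap e'"
    and "0 \<le> lo"
    and "c \<in> edge_costs \<Sigma> e \<Longrightarrow> lo \<le> gl + c"
    and "lo < gs \<Longrightarrow> gl + \<alpha> e \<le> lo"
    and "lo < gs \<Longrightarrow> c \<in> edge_costs \<Sigma> e \<Longrightarrow> gu + c \<le> up"
    and "lo < gs \<Longrightarrow> lo = 0 \<Longrightarrow> c \<in> edge_costs \<Sigma> e \<Longrightarrow> gl = 0 \<and> c = 0"
proof -
  obtain \<theta> where t: "get_estimator ord ap e = Some \<theta>" "\<theta> \<in> estimators P e" "\<alpha> e = cmin P \<theta>"
    using first_estimator e ap by blast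
  \<comment> \<open>Since the ratio starts at infinity and an estimator is available, the loop can
    be skipped only if \<open>gs\<close> is not positive. Then \<open>lo < gs\<close> fails too, so
    the claims under that hypothesis concern only the second alternative.\<close>
  have dich: "(\<not> 0 < gs \<and> lo = 0 \<and> ap' = ap) \<or>
    (ap' e \<subseteq> estimators P e \<and> \<theta> \<in> ap' e \<and> (\<forall>e'. e' \<noteq> e \<longrightarrow> ap' e' = ap e') \<and>
     lo = gl + lower_bound P ap' e \<and> up = gu + upper_bound P ap' e)"
    using est
  proof cases
    case stop
    then show ?thesis using t by auto
  next
    case (apply_est \<theta>' ap1 lo1 up1)
    then have "\<theta>' = \<theta>" using t by simp
    then have "ap1 e = {\<theta>}" "\<And>e'. e' \<noteq> e \<Longrightarrow> ap1 e' = ap e'" using apply_est ap by auto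
    then show ?thesis
      using estimate_bounds_aux[OF apply_est(7) e, of \<theta>] t(2) apply_est(5,6) by simp
  qed
  note tb = tightest_bounds[OF e, of ap' \<theta>]
  show "\<And>e'. e' \<noteq> e \<Longrightarrow> ap' e' = ap e'" using dich by auto
  have a: "0 \<le> cmin P \<theta>" using cmin_nonneg e t by simp
  show "0 \<le> lo" using dich tb(1) a gl(1) by (metis add_nonneg_nonneg order.refl order.trans)
  show "lo \<le> gl + c" if c: "c \<in> edge_costs \<Sigma> e"
    using dich tb(2) gl(1) edge_costs_bounds[OF c] c by (metis add_left_mono add_nonneg_nonneg)
  assume "lo < gs"
  then have d: "ap' e \<subseteq> estimators P e" "\<theta> \<in> ap' e"
    "lo = gl + lower_bound P ap' e" "up = gu + upper_bound P ap' e"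
    using dich by auto
  show "gl + \<alpha> e \<le> lo" using d tb(1) t(3) by (simp add: add_left_mono)
  show "gu + c \<le> up" if "c \<in> edge_costs \<Sigma> e" using d tb(3) that by (simp add: add_left_mono)
  show "gl = 0 \<and> c = 0" if "lo = 0" "c \<in> edge_costs \<Sigma> e"
    using that d tb(1,4) a gl(1) by (metis add_nonneg_eq_0_iff order.trans)
qed

end

section \<open>The invariant of a run\<close>

locale asec_run = estimation_problem P ord \<epsilon>
  for P :: "('s, 'a, 't) planning_problem" and ord \<epsilon> +
  fixes hv :: "'s \<Rightarrow> ereal"
  assumes hv_not_minf: "s \<in> states \<Sigma> \<Longrightarrow> hv s \<noteq> -\<infinity>"
    and hv_consistent: "(n, s) \<in> edges \<Sigma> \<Longrightarrow> hv n \<le> \<alpha> (n, s) + hv s"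
    and hv_goal: "s \<in> goals P \<Longrightarrow> hv s = 0"
begin

text \<open>
  The set \<open>R\<close> contains the edges of the node under expansion that are still to be processed.
\<close>

definition live :: "('s \<times> 's) set \<Rightarrow> ('s, 't) asec_state \<Rightarrow> bool" where
  "live R \<sigma> \<longleftrightarrow>
     OPEN \<sigma> \<union> CLOSED \<sigma> \<subseteq> states \<Sigma> \<and> OPEN \<sigma> \<inter> CLOSED \<sigma> = {} \<and> CLOSED \<sigma> \<inter> goals P = {} \<and>
     (\<forall>s\<in>OPEN \<sigma> \<union> CLOSED \<sigma>. 0 \<le> gmin \<sigma> s \<and> gmin \<sigma> s < \<infinity> \<and> fval \<sigma> s = gmin \<sigma> s + hv s) \<and>
     (\<forall>m\<in>CLOSED \<sigma>. hv m < \<infinity> \<and> (\<forall>s\<in>OPEN \<sigma>. fval \<sigma> m \<le> fval \<sigma> s)) \<and>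
     (\<forall>e. fst e \<notin> CLOSED \<sigma> \<or> e \<in> R \<longrightarrow> applied_est \<sigma> e = {}) \<and>
     (\<forall>n\<in>CLOSED \<sigma>. \<forall>s. (n, s) \<in> edges \<Sigma> - R \<longrightarrow>
        s \<in> OPEN \<sigma> \<union> CLOSED \<sigma> \<and> (\<forall>c\<in>edge_costs \<Sigma> (n, s). gmin \<sigma> s \<le> gmin \<sigma> n + c)) \<and>
     initial_state P \<in> OPEN \<sigma> \<union> CLOSED \<sigma> \<and>
     gmin \<sigma> (initial_state P) = 0 \<and> gmax \<sigma> (initial_state P) = 0 \<and>
     (\<forall>s\<in>OPEN \<sigma> \<union> CLOSED \<sigma> - {initial_state P}. \<exists>n\<in>CLOSED \<sigma>. parent \<sigma> s = Some n \<and>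
        (\<forall>c\<in>edge_costs \<Sigma> (n, s). gmax \<sigma> n + c \<le> gmax \<sigma> s \<and>
           (gmin \<sigma> s = 0 \<longrightarrow> gmin \<sigma> n = 0 \<and> c = 0)))"

text \<open>Roles of the conjuncts: \<open>live_closed_le_open\<close> and
  \<open>live_closed\<close> prevent reopening, \<open>live_fresh\<close> makes each estimation
  start from scratch, \<open>live_successor_gmin\<close> carries the lower bound along arbitrary
  plans, and \<open>live_parent\<close> carries the upper bound, together with the zero case, along
  parents.\<close>

lemma liveD:
  assumes "live R \<sigma>"
  shows live_states: "OPEN \<sigma> \<union> CLOSED \<sigma> \<subseteq> states \<Sigma>"
    and live_disjoint: "OPEN \<sigma> \<inter> CLOSED \<sigma> = {}"
    and live_goals: "CLOSED \<sigma> \<inter> goals P = {}"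
    and live_gmin: "s \<in> OPEN \<sigma> \<union> CLOSED \<sigma> \<Longrightarrow>
      0 \<le> gmin \<sigma> s \<and> gmin \<sigma> s < \<infinity> \<and> fval \<sigma> s = gmin \<sigma> s + hv s"
    and live_closed: "m \<in> CLOSED \<sigma> \<Longrightarrow> hv m < \<infinity>"
    and live_closed_le_open: "m \<in> CLOSED \<sigma> \<Longrightarrow> t \<in> OPEN \<sigma> \<Longrightarrow> fval \<sigma> m \<le> fval \<sigma> t"
    and live_fresh: "fst e \<notin> CLOSED \<sigma> \<or> e \<in> R \<Longrightarrow> applied_est \<sigma> e = {}"
    and live_successor: "n \<in> CLOSED \<sigma> \<Longrightarrow> (n, s) \<in> edges \<Sigma> \<Longrightarrow> (n, s) \<notin> R \<Longrightarrow> s \<in> OPEN \<sigma> \<union> CLOSED \<sigma>"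
    and live_successor_gmin: "n \<in> CLOSED \<sigma> \<Longrightarrow> (n, s) \<in> edges \<Sigma> \<Longrightarrow> (n, s) \<notin> R \<Longrightarrow>
      c \<in> edge_costs \<Sigma> (n, s) \<Longrightarrow> gmin \<sigma> s \<le> gmin \<sigma> n + c"
    and live_start: "initial_state P \<in> OPEN \<sigma> \<union> CLOSED \<sigma>"
      "gmin \<sigma> (initial_state P) = 0" "gmax \<sigma> (initial_state P) = 0"
    and live_parent: "s \<in> OPEN \<sigma> \<union> CLOSED \<sigma> \<Longrightarrow> s \<noteq> initial_state P \<Longrightarrow>
      \<exists>n\<in>CLOSED \<sigma>. parent \<sigma> s = Some n \<and>
        (\<forall>c\<in>edge_costs \<Sigma> (n, s). gmax \<sigma> n + c \<le> gmax \<sigma> s \<and>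
           (gmin \<sigma> s = 0 \<longrightarrow> gmin \<sigma> n = 0 \<and> c = 0))"
proof -
  note A = assms[unfolded live_def]
  note A2 = A[THEN conjunct2]
  note A3 = A2[THEN conjunct2]
  note A4 = A3[THEN conjunct2]
  note A5 = A4[THEN conjunct2]
  note A6 = A5[THEN conjunct2]
  note A7 = A6[THEN conjunct2]
  note A8 = A7[THEN conjunct2]
  note A9 = A8[THEN conjunct2]
  note A10 = A9[THEN conjunct2]
  note A11 = A10[THEN conjunct2]
  show "OPEN \<sigma> \<union> CLOSED \<sigma> \<subseteq> states \<Sigma>" "OPEN \<sigma> \<inter> CLOSED \<sigma> = {}" "CLOSED \<sigma> \<inter> goals P = {}"
    by (fact A[THEN conjunct1] A2[THEN conjunct1] A3[THEN conjunct1])+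
  show "initial_state P \<in> OPEN \<sigma> \<union> CLOSED \<sigma>" "gmin \<sigma> (initial_state P) = 0"
    "gmax \<sigma> (initial_state P) = 0"
    by (fact A8[THEN conjunct1] A9[THEN conjunct1] A10[THEN conjunct1])+
  show "0 \<le> gmin \<sigma> s \<and> gmin \<sigma> s < \<infinity> \<and> fval \<sigma> s = gmin \<sigma> s + hv s" if "s \<in> OPEN \<sigma> \<union> CLOSED \<sigma>"
    using A4[THEN conjunct1] that by blast
  show "hv m < \<infinity>" if "m \<in> CLOSED \<sigma>"
    using A5[THEN conjunct1] that by blast
  show "fval \<sigma> m \<le> fval \<sigma> t" if "m \<in> CLOSED \<sigma>" "t \<in> OPEN \<sigma>"
    using A5[THEN conjunct1] that by blast
  show "applied_est \<sigma> e = {}" if "fst e \<notin> CLOSED \<sigma> \<or> e \<in> R"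
    using A6[THEN conjunct1, rule_format, OF that] .
  show "s \<in> OPEN \<sigma> \<union> CLOSED \<sigma>" if "n \<in> CLOSED \<sigma>" "(n, s) \<in> edges \<Sigma>" "(n, s) \<notin> R"
    using A7[THEN conjunct1] that by blast
  show "gmin \<sigma> s \<le> gmin \<sigma> n + c"
    if "n \<in> CLOSED \<sigma>" "(n, s) \<in> edges \<Sigma>" "(n, s) \<notin> R" "c \<in> edge_costs \<Sigma> (n, s)"
    using A7[THEN conjunct1] that by blast
  show "\<exists>n\<in>CLOSED \<sigma>. parent \<sigma> s = Some n \<and>
        (\<forall>c\<in>edge_costs \<Sigma> (n, s). gmax \<sigma> n + c \<le> gmax \<sigma> s \<and>
           (gmin \<sigma> s = 0 \<longrightarrow> gmin \<sigma> n = 0 \<and> c = 0))"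
    if "s \<in> OPEN \<sigma> \<union> CLOSED \<sigma>" "s \<noteq> initial_state P"
    by (rule bspec[OF A11]) (use that in simp)
qed

section \<open>Preservation of the invariant during an expansion\<close>

lemma live_initial:
  assumes "asec_initial P hv \<sigma>"
  shows "live {} \<sigma>"
  using assms wf by (auto simp: live_def asec_initial_def wf_problem_def)

text \<open>The invariant reads \<open>gmin\<close> only at nodes of \<open>OPEN\<close> and
  \<open>CLOSED\<close>: the successors, parents and initial state it mentions all lie
  there.\<close>

lemma live_reset:
  assumes L: "live R \<sigma>" and s: "s \<notin> OPEN \<sigma> \<union> CLOSED \<sigma>"
  shows "live R (\<sigma>\<lparr>gmin := (gmin \<sigma>)(s := \<infinity>)\<rparr>)"
proof -
  define \<sigma>' where "\<sigma>' = \<sigma>\<lparr>gmin := (gmin \<sigma>)(s := \<infinity>)\<rparr>"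
  have eq: "OPEN \<sigma>' = OPEN \<sigma>" "CLOSED \<sigma>' = CLOSED \<sigma>" "gmax \<sigma>' = gmax \<sigma>" "fval \<sigma>' = fval \<sigma>"
    "parent \<sigma>' = parent \<sigma>" "applied_est \<sigma>' = applied_est \<sigma>"
    by (simp_all add: \<sigma>'_def)
  have g: "gmin \<sigma>' t = gmin \<sigma> t" if "t \<in> OPEN \<sigma> \<union> CLOSED \<sigma>" for t
    using that s by (auto simp: \<sigma>'_def)
  have gC: "gmin \<sigma>' t = gmin \<sigma> t" if "t \<in> CLOSED \<sigma>" for t
    using that g by blast
  have "live R \<sigma>'"
    unfolding live_def eq
  proof (intro conjI ballI allI impI)
    fix t assume t: "t \<in> OPEN \<sigma> \<union> CLOSED \<sigma> - {initial_state P}"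
    then obtain n where "n \<in> CLOSED \<sigma>" "parent \<sigma> t = Some n"
      "\<forall>c\<in>edge_costs \<Sigma> (n, t). gmax \<sigma> n + c \<le> gmax \<sigma> t \<and>
           (gmin \<sigma> t = 0 \<longrightarrow> gmin \<sigma> n = 0 \<and> c = 0)"
      using live_parent[OF L, of t] by blast
    then show "\<exists>n\<in>CLOSED \<sigma>. parent \<sigma> t = Some n \<and>
        (\<forall>c\<in>edge_costs \<Sigma> (n, t). gmax \<sigma> n + c \<le> gmax \<sigma> t \<and>
           (gmin \<sigma>' t = 0 \<longrightarrow> gmin \<sigma>' n = 0 \<and> c = 0))"
      using g[of t] gC[of n] t by simp
  next
    fix n t c assume "n \<in> CLOSED \<sigma>" "(n, t) \<in> edges \<Sigma> - R" "c \<in> edge_costs \<Sigma> (n, t)"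
    then show "gmin \<sigma>' t \<le> gmin \<sigma>' n + c"
      using live_successor_gmin[OF L] live_successor[OF L] g[of t] gC[of n] by simp
  qed (use g live_start[OF L] live_gmin[OF L] liveD[OF L] in simp_all)
  then show ?thesis by (simp add: \<sigma>'_def)
qed

text \<open>Discharges the edge \<open>(n, s)\<close> from the pending set, both when
  \<open>s\<close> is left alone and after an improvement of \<open>s\<close>. Its applied
  estimators may change freely, as \<open>n\<close> is closed and the edge is no longer
  pending.\<close>

lemma live_skip:
  assumes L: "live R \<sigma>" and n: "n \<in> CLOSED \<sigma>" and s: "s \<in> OPEN \<sigma> \<union> CLOSED \<sigma>"
    and ap: "\<And>e. e \<noteq> (n, s) \<Longrightarrow> ap e = applied_est \<sigma> e"
    and le: "\<And>c. c \<in> edge_costs \<Sigma> (n, s) \<Longrightarrow> gmin \<sigma> s \<le> gmin \<sigma> n + c"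
  shows "live (R - {(n, s)}) (\<sigma>\<lparr>applied_est := ap\<rparr>)"
proof -
  have eq: "OPEN (\<sigma>\<lparr>applied_est := ap\<rparr>) = OPEN \<sigma>"
    "CLOSED (\<sigma>\<lparr>applied_est := ap\<rparr>) = CLOSED \<sigma>" "gmin (\<sigma>\<lparr>applied_est := ap\<rparr>) = gmin \<sigma>"
    "gmax (\<sigma>\<lparr>applied_est := ap\<rparr>) = gmax \<sigma>" "fval (\<sigma>\<lparr>applied_est := ap\<rparr>) = fval \<sigma>"
    "parent (\<sigma>\<lparr>applied_est := ap\<rparr>) = parent \<sigma>" "applied_est (\<sigma>\<lparr>applied_est := ap\<rparr>) = ap"
    by simp_all
  have "\<forall>e. fst e \<notin> CLOSED \<sigma> \<or> e \<in> R - {(n, s)} \<longrightarrow> ap e = {}"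
    using live_fresh[OF L] n ap by (metis Diff_iff fst_conv insertI1)
  moreover have "\<forall>m\<in>CLOSED \<sigma>. \<forall>t. (m, t) \<in> edges \<Sigma> - (R - {(n, s)}) \<longrightarrow>
        t \<in> OPEN \<sigma> \<union> CLOSED \<sigma> \<and> (\<forall>c\<in>edge_costs \<Sigma> (m, t). gmin \<sigma> t \<le> gmin \<sigma> m + c)"
    using live_successor[OF L] live_successor_gmin[OF L] s le by blast
  ultimately show ?thesis
    using L unfolding live_def eq
    by - (elim conjE, (intro conjI; assumption))
qed

text \<open>As \<open>n\<close> has the largest f-value among closed nodes and consistency gives
  \<open>fval \<sigma> n \<le> lo + hv s\<close>, a closed \<open>s\<close> could not be improved.
  So only an open or new node changes, and the data of all closed nodes, in particular of all
  parents, stay fixed.\<close>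

lemma live_improve:
  assumes L: "live R \<sigma>" and n: "n \<in> CLOSED \<sigma>" and e: "(n, s) \<in> edges \<Sigma>"
    and max: "\<And>m. m \<in> CLOSED \<sigma> \<Longrightarrow> fval \<sigma> m \<le> fval \<sigma> n"
    and lo: "0 \<le> lo" "gmin \<sigma> n + \<alpha> (n, s) \<le> lo" "lo < gmin \<sigma> s"
    and lo_le: "\<And>c. c \<in> edge_costs \<Sigma> (n, s) \<Longrightarrow> lo \<le> gmin \<sigma> n + c"
    and up: "\<And>c. c \<in> edge_costs \<Sigma> (n, s) \<Longrightarrow> gmax \<sigma> n + c \<le> up"
    and zero: "\<And>c. lo = 0 \<Longrightarrow> c \<in> edge_costs \<Sigma> (n, s) \<Longrightarrow> gmin \<sigma> n = 0 \<and> c = 0"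
  defines "\<sigma>' \<equiv> \<sigma>\<lparr>gmin := (gmin \<sigma>)(s := lo), gmax := (gmax \<sigma>)(s := up),
                  parent := (parent \<sigma>)(s := Some n),
                  OPEN := insert s (OPEN \<sigma>), CLOSED := CLOSED \<sigma> - {s},
                  fval := (fval \<sigma>)(s := lo + hv s)\<rparr>"
  shows "s \<notin> CLOSED \<sigma>" "live R \<sigma>'"
proof -
  have fn: "fval \<sigma> n = gmin \<sigma> n + hv n" using live_gmin[OF L] n by blast
  have "fval \<sigma> n \<le> gmin \<sigma> n + (\<alpha> (n, s) + hv s)"
    unfolding fn by (rule add_left_mono[OF hv_consistent[OF e]])
  also have "\<dots> \<le> lo + hv s" unfolding add.assoc[symmetric] by (rule add_right_mono[OF lo(2)])
  finally have f_le: "fval \<sigma> n \<le> lo + hv s" .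
  show sC: "s \<notin> CLOSED \<sigma>"
  proof
    assume s: "s \<in> CLOSED \<sigma>"
    then have "fval \<sigma> s = gmin \<sigma> s + hv s" using live_gmin[OF L] by blast
    then have "hv s + gmin \<sigma> s \<le> hv s + lo"
      using max[OF s] f_le by (metis order.trans add.commute)
    \<comment> \<open>Cancelling \<open>hv s\<close> in extended reals needs it finite; this is why
      \<open>live\<close> demands \<open>hv m < \<infinity>\<close> of closed nodes.\<close>
    moreover have "hv s \<noteq> \<infinity>" "hv s \<noteq> -\<infinity>"
      using s live_closed[OF L s] hv_not_minf live_states[OF L] by auto
    ultimately have "gmin \<sigma> s \<le> lo" by (simp add: ereal_add_le_add_iff)
    then show False using lo(3) by simp
  qed
  \<comment> \<open>The initial state has \<open>gmin\<close> 0, which no nonnegative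
    \<open>lo\<close> can improve.\<close>
  have s0: "s \<noteq> initial_state P" using lo(1,3) live_start[OF L] by auto
  have lofin: "lo < \<infinity>" using lo(3) by (cases lo) auto
  have eC: "CLOSED \<sigma>' = CLOSED \<sigma>" and eO: "OPEN \<sigma>' = insert s (OPEN \<sigma>)"
    and e1: "gmin \<sigma>' s = lo" "gmax \<sigma>' s = up" "parent \<sigma>' s = Some n" "fval \<sigma>' s = lo + hv s"
    and eA: "applied_est \<sigma>' = applied_est \<sigma>"
    and e2: "\<And>t. t \<noteq> s \<Longrightarrow> gmin \<sigma>' t = gmin \<sigma> t \<and> gmax \<sigma>' t = gmax \<sigma> t \<and>
      parent \<sigma>' t = parent \<sigma> t \<and> fval \<sigma>' t = fval \<sigma> t"
    using sC by (auto simp: \<sigma>'_def)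
  have eCl: "t \<in> CLOSED \<sigma> \<Longrightarrow> gmin \<sigma>' t = gmin \<sigma> t \<and> gmax \<sigma>' t = gmax \<sigma> t \<and> fval \<sigma>' t = fval \<sigma> t" for t
    using e2 sC by metis
  \<comment> \<open>Lower bounds only decrease at targets of edges and are unchanged at closed
    sources, so the inequalities along expanded edges survive.\<close>
  have gle: "gmin \<sigma>' t \<le> gmin \<sigma> t" for t using e1 e2 lo(3) by (cases "t = s") auto
  have 1: "OPEN \<sigma>' \<union> CLOSED \<sigma>' \<subseteq> states \<Sigma> \<and> OPEN \<sigma>' \<inter> CLOSED \<sigma>' = {} \<and> CLOSED \<sigma>' \<inter> goals P = {}"
    unfolding eC eO using live_states[OF L] live_disjoint[OF L] live_goals[OF L] sC edge_states[OF e] by blast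
  have 2: "\<forall>t\<in>OPEN \<sigma>' \<union> CLOSED \<sigma>'. 0 \<le> gmin \<sigma>' t \<and> gmin \<sigma>' t < \<infinity> \<and> fval \<sigma>' t = gmin \<sigma>' t + hv t"
  proof
    fix t assume "t \<in> OPEN \<sigma>' \<union> CLOSED \<sigma>'"
    then show "0 \<le> gmin \<sigma>' t \<and> gmin \<sigma>' t < \<infinity> \<and> fval \<sigma>' t = gmin \<sigma>' t + hv t"
      using live_gmin[OF L, of t] e1 e2[of t] lo(1) lofin unfolding eC eO by (cases "t = s") auto
  qed
  have 3: "\<forall>m\<in>CLOSED \<sigma>'. hv m < \<infinity> \<and> (\<forall>t\<in>OPEN \<sigma>'. fval \<sigma>' m \<le> fval \<sigma>' t)"
  proof (intro ballI conjI)
    fix m assume m: "m \<in> CLOSED \<sigma>'"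
    then show "hv m < \<infinity>" using live_closed[OF L] eC by blast
    fix t assume t: "t \<in> OPEN \<sigma>'"
    show "fval \<sigma>' m \<le> fval \<sigma>' t"
    proof (cases "t = s")
      case True
      then show ?thesis using order.trans[OF max f_le] m e1 eCl[of m] eC by simp
    next
      case False
      then show ?thesis using live_closed_le_open[OF L, of m t] m t e2[OF False] eCl[of m] eC eO by simp
    qed
  qed
  have 4: "\<forall>m\<in>CLOSED \<sigma>'. \<forall>t. (m, t) \<in> edges \<Sigma> - R \<longrightarrow>
        t \<in> OPEN \<sigma>' \<union> CLOSED \<sigma>' \<and> (\<forall>c\<in>edge_costs \<Sigma> (m, t). gmin \<sigma>' t \<le> gmin \<sigma>' m + c)"
  proof (intro ballI allI impI conjI)
    fix m t assume m: "m \<in> CLOSED \<sigma>'" and t: "(m, t) \<in> edges \<Sigma> - R"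
    then show "t \<in> OPEN \<sigma>' \<union> CLOSED \<sigma>'" using live_successor[OF L, of m t] eC eO by blast
    fix c assume "c \<in> edge_costs \<Sigma> (m, t)"
    then have "gmin \<sigma> t \<le> gmin \<sigma> m + c" using live_successor_gmin[OF L, of m t] eC m t by blast
    then show "gmin \<sigma>' t \<le> gmin \<sigma>' m + c" using order.trans[OF gle[of t]] eCl[of m] m eC by simp
  qed
  have 5: "\<exists>m\<in>CLOSED \<sigma>'. parent \<sigma>' t = Some m \<and>
        (\<forall>c\<in>edge_costs \<Sigma> (m, t). gmax \<sigma>' m + c \<le> gmax \<sigma>' t \<and>
           (gmin \<sigma>' t = 0 \<longrightarrow> gmin \<sigma>' m = 0 \<and> c = 0))"
    if t: "t \<in> OPEN \<sigma>' \<union> CLOSED \<sigma>' - {initial_state P}" for t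
  proof (cases "t = s")
    case True
    then show ?thesis using n eC e1 eCl[OF n] up zero by (intro bexI[of _ n]) auto
  next
    case False
    then obtain m where "m \<in> CLOSED \<sigma>" "parent \<sigma> t = Some m"
      "\<forall>c\<in>edge_costs \<Sigma> (m, t). gmax \<sigma> m + c \<le> gmax \<sigma> t \<and> (gmin \<sigma> t = 0 \<longrightarrow> gmin \<sigma> m = 0 \<and> c = 0)"
      using live_parent[OF L, of t] t eC eO by blast
    then show ?thesis using e2[OF False] eCl[of m] eC by (intro bexI[of _ m]) auto
  qed
  have 6: "initial_state P \<in> OPEN \<sigma>' \<union> CLOSED \<sigma>' \<and>
     gmin \<sigma>' (initial_state P) = 0 \<and> gmax \<sigma>' (initial_state P) = 0"
    using live_start[OF L] e2[of "initial_state P"] s0 eC eO by auto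
  have 7: "\<forall>e. fst e \<notin> CLOSED \<sigma>' \<or> e \<in> R \<longrightarrow> applied_est \<sigma>' e = {}" using live_fresh[OF L] eA eC by simp
  have 8: "\<forall>t\<in>OPEN \<sigma>' \<union> CLOSED \<sigma>' - {initial_state P}. \<exists>m\<in>CLOSED \<sigma>'. parent \<sigma>' t = Some m \<and>
        (\<forall>c\<in>edge_costs \<Sigma> (m, t). gmax \<sigma>' m + c \<le> gmax \<sigma>' t \<and>
           (gmin \<sigma>' t = 0 \<longrightarrow> gmin \<sigma>' m = 0 \<and> c = 0))"
    by (rule ballI) (rule 5)
  show "live R \<sigma>'"
    unfolding live_def using 1 2 3 4 6 7 8 by - (elim conjE, (intro conjI; assumption))
qed

text \<open>The extra conclusions about \<open>CLOSED\<close> and \<open>fval\<close> keep the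
  maximality of \<open>n\<close> available for the next successor.\<close>

lemma live_process_successor:
  assumes "process_successor P ord \<epsilon> hv n s \<sigma> \<sigma>'"
    and L: "live R \<sigma>" and n: "n \<in> CLOSED \<sigma>" and e: "(n, s) \<in> edges \<Sigma>" "(n, s) \<in> R"
    and max: "\<And>m. m \<in> CLOSED \<sigma> \<Longrightarrow> fval \<sigma> m \<le> fval \<sigma> n"
  shows "live (R - {(n, s)}) \<sigma>' \<and> CLOSED \<sigma>' = CLOSED \<sigma> \<and> (\<forall>m\<in>CLOSED \<sigma>. fval \<sigma>' m = fval \<sigma> m)"
  using assms(1)
proof cases
  case (1 \<sigma>1 up0 \<eta> lo up ap \<sigma>2)
  have L1: "live R \<sigma>1" using 1(1) L live_reset by auto
  have C1: "CLOSED \<sigma>1 = CLOSED \<sigma>" "fval \<sigma>1 = fval \<sigma>" "OPEN \<sigma>1 = OPEN \<sigma>" using 1(1) by auto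
  \<comment> \<open>The edge is still pending, hence unestimated, which is what
    \<open>estimate_fresh\<close> requires.\<close>
  have ap0: "applied_est \<sigma>1 (n, s) = {}" using live_fresh[OF L1] e by blast
  have gn: "0 \<le> gmin \<sigma>1 n" "gmin \<sigma>1 n < \<infinity>" using live_gmin[OF L1, of n] n C1 by auto
  note E = estimate_fresh[OF 1(2) e(1) ap0 gn]
  obtain c where c: "c \<in> edge_costs \<Sigma> (n, s)" using edge_costs_nonempty e by blast
  have "gmin \<sigma>1 n + c < \<infinity>" using gn edge_costs_bounds[OF c] by simp
  then have lofin: "lo < \<infinity>" using E(3)[OF c] le_less_trans by blast
  show ?thesis
  proof (cases "lo < gmin \<sigma>1 s")
    case False
    \<comment> \<open>An unknown \<open>s\<close> has just received \<open>gmin\<close> infinity,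
      and the finite \<open>lo\<close> would improve on it.\<close>
    have s: "s \<in> OPEN \<sigma>1 \<union> CLOSED \<sigma>1"
    proof (rule ccontr)
      assume "s \<notin> OPEN \<sigma>1 \<union> CLOSED \<sigma>1"
      then have "gmin \<sigma>1 s = \<infinity>" using 1(1) C1 by auto
      then show False using False lofin by simp
    qed
    have "live (R - {(n, s)}) (\<sigma>1\<lparr>applied_est := ap\<rparr>)"
      using L1 n C1 s E(1,3) False by (intro live_skip) (auto simp: not_less intro: order.trans)
    then show ?thesis using 1 False C1 by auto
  next
    case True
    define \<sigma>3 where "\<sigma>3 = \<sigma>1\<lparr>gmin := (gmin \<sigma>1)(s := lo), gmax := (gmax \<sigma>1)(s := up),
                  parent := (parent \<sigma>1)(s := Some n),
                  OPEN := insert s (OPEN \<sigma>1), CLOSED := CLOSED \<sigma>1 - {s},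
                  fval := (fval \<sigma>1)(s := lo + hv s)\<rparr>"
    have n1: "n \<in> CLOSED \<sigma>1" and max1: "\<And>m. m \<in> CLOSED \<sigma>1 \<Longrightarrow> fval \<sigma>1 m \<le> fval \<sigma>1 n"
      using n max C1 by auto
    note improve = live_improve[OF L1 n1 e(1) max1 E(2) E(4)[OF True] True E(3) E(5)[OF True]
        E(6)[OF True]]
    have I: "s \<notin> CLOSED \<sigma>1" "live R \<sigma>3" unfolding \<sigma>3_def by (rule improve; assumption)+
    have C3: "CLOSED \<sigma>3 = CLOSED \<sigma>" "\<forall>m\<in>CLOSED \<sigma>. fval \<sigma>3 m = fval \<sigma> m"
      using I(1) C1 by (auto simp: \<sigma>3_def)
    \<comment> \<open>No self-loop improves its node, so the update at \<open>s\<close> leaves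
      \<open>gmin\<close> of \<open>n\<close> intact and the bound on \<open>lo\<close> remains
      usable.\<close>
    have "n \<noteq> s" using I(1) n C1 by blast
    then have "live (R - {(n, s)}) (\<sigma>3\<lparr>applied_est := ap\<rparr>)"
    proof (intro live_skip)
      show "n \<in> CLOSED \<sigma>3" "s \<in> OPEN \<sigma>3 \<union> CLOSED \<sigma>3" using n C3 by (auto simp: \<sigma>3_def)
      show "ap e = applied_est \<sigma>3 e" if "e \<noteq> (n, s)" for e using E(1)[OF that] by (simp add: \<sigma>3_def)
      show "gmin \<sigma>3 s \<le> gmin \<sigma>3 n + c" if "c \<in> edge_costs \<Sigma> (n, s)" for c
        using E(3)[OF that] \<open>n \<noteq> s\<close> by (simp add: \<sigma>3_def)
    qed (rule I(2))
    moreover have "\<sigma>' = \<sigma>3\<lparr>applied_est := ap\<rparr>" using 1 True by (simp add: \<sigma>3_def)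
    ultimately show ?thesis using C3 by simp
  qed
qed

lemma live_process_successors:
  assumes "process_successors P ord \<epsilon> hv n ss \<sigma> \<sigma>'"
    and "live ({n} \<times> set ss) \<sigma>" "n \<in> CLOSED \<sigma>" "distinct ss"
    and "set ss \<subseteq> {s. (n, s) \<in> edges \<Sigma>}"
    and "\<And>m. m \<in> CLOSED \<sigma> \<Longrightarrow> fval \<sigma> m \<le> fval \<sigma> n"
  shows "live {} \<sigma>'"
  using assms
proof (induction rule: process_successors.induct)
  case (Nil \<sigma>)
  then show ?case by simp
next
  case (Cons s \<sigma> \<sigma>' ss \<sigma>'')
  have "live ({n} \<times> set (s # ss) - {(n, s)}) \<sigma>' \<and> CLOSED \<sigma>' = CLOSED \<sigma> \<and>
    (\<forall>m\<in>CLOSED \<sigma>. fval \<sigma>' m = fval \<sigma> m)"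
    using Cons by (intro live_process_successor) auto
  \<comment> \<open>Distinctness of the successor list ensures that no pending edge other than
    \<open>(n, s)\<close> is discharged.\<close>
  moreover have "{n} \<times> set (s # ss) - {(n, s)} = {n} \<times> set ss" using Cons.prems by auto
  ultimately show ?case using Cons by simp
qed

section \<open>Dead ends and whole runs\<close>

lemma OPEN_process_successors:
  assumes "process_successors P ord \<epsilon> hv n ss \<sigma> \<sigma>'"
  shows "OPEN \<sigma>' \<subseteq> OPEN \<sigma> \<union> set ss"
  using assms
proof (induction rule: process_successors.induct)
  case (Cons s \<sigma> \<sigma>' ss \<sigma>'')
  from Cons(1) have "OPEN \<sigma>' \<subseteq> insert s (OPEN \<sigma>)" by cases auto
  then show ?case using Cons by auto
qed auto

text \<open>
  A node with infinite heuristic value has only such successors. Closed nodes may be reopened once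
  such a node has been selected, but by then no goal can be reached from \<open>OPEN\<close> any more.
\<close>

lemma dead_step:
  assumes "asec_step P ord \<epsilon> hv \<sigma> \<sigma>'" "\<forall>m\<in>OPEN \<sigma>. hv m = \<infinity>"
  shows "\<forall>m\<in>OPEN \<sigma>'. hv m = \<infinity>"
  using assms(1)
proof cases
  case (1 n ss)
  have n: "hv n = \<infinity>" using 1 assms(2) by (auto simp: min_open_def)
  have "hv s = \<infinity>" if "s \<in> set ss" for s
  proof -
    have e: "(n, s) \<in> edges \<Sigma>" using 1 that by blast
    \<comment> \<open>As \<open>\<alpha>\<close> is finite on edges, consistency passes the infinite
      value from \<open>n\<close> to \<open>s\<close>.\<close>
    then show ?thesis using hv_consistent[OF e] n first_lower_bound_bounds[OF e] by auto
  qed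
  then show ?thesis using OPEN_process_successors[OF 1(5)] assms(2) by auto
qed

lemma live_step:
  assumes "asec_step P ord \<epsilon> hv \<sigma> \<sigma>'" "live {} \<sigma>" "\<exists>m\<in>OPEN \<sigma>. hv m \<noteq> \<infinity>"
  shows "live {} \<sigma>'"
  using assms(1)
proof cases
  case (1 n ss)
  let ?\<sigma> = "\<sigma>\<lparr>OPEN := OPEN \<sigma> - {n}, CLOSED := insert n (CLOSED \<sigma>)\<rparr>"
  note Ld = assms(2)[unfolded live_def]
  have n: "n \<in> OPEN \<sigma>" "\<forall>m\<in>OPEN \<sigma>. fval \<sigma> n \<le> fval \<sigma> m" using 1 by (auto simp: min_open_def)
  have nC: "n \<notin> CLOSED \<sigma>" using n Ld by blast
  obtain m where m: "m \<in> OPEN \<sigma>" "hv m \<noteq> \<infinity>" using assms(3) by blast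
  \<comment> \<open>Some open node has a finite f-value, so the minimal one is finite too, and
    \<open>n\<close> meets the requirement on closed nodes.\<close>
  have "gmin \<sigma> n + hv n \<le> gmin \<sigma> m + hv m" using n m Ld by (metis UnI1)
  also have "\<dots> < \<infinity>" using m Ld by (auto simp: less_top)
  finally have hn: "hv n < \<infinity>" by (auto simp: less_top)
  \<comment> \<open>On entering \<open>CLOSED\<close>, all outgoing edges of \<open>n\<close> become
    pending; they are fresh because \<open>n\<close> was not closed before.\<close>
  have "live ({n} \<times> set ss) ?\<sigma>"
  proof -
    have a: "OPEN ?\<sigma> \<union> CLOSED ?\<sigma> = OPEN \<sigma> \<union> CLOSED \<sigma>" using n by auto
    have b: "\<forall>e. fst e \<notin> CLOSED ?\<sigma> \<or> e \<in> {n} \<times> set ss \<longrightarrow> applied_est ?\<sigma> e = {}"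
      using Ld nC by auto
    have c: "\<forall>k\<in>CLOSED ?\<sigma>. \<forall>s. (k, s) \<in> edges \<Sigma> - {n} \<times> set ss \<longrightarrow>
        s \<in> OPEN \<sigma> \<union> CLOSED \<sigma> \<and> (\<forall>c\<in>edge_costs \<Sigma> (k, s). gmin ?\<sigma> s \<le> gmin ?\<sigma> k + c)"
      using Ld 1(4) by auto
    have d: "\<forall>k\<in>CLOSED ?\<sigma>. hv k < \<infinity> \<and> (\<forall>s\<in>OPEN ?\<sigma>. fval ?\<sigma> k \<le> fval ?\<sigma> s)"
      using Ld n hn by auto
    have f: "\<forall>s\<in>OPEN \<sigma> \<union> CLOSED \<sigma> - {initial_state P}. \<exists>k\<in>CLOSED ?\<sigma>. parent ?\<sigma> s = Some k \<and>
        (\<forall>c\<in>edge_costs \<Sigma> (k, s). gmax ?\<sigma> k + c \<le> gmax ?\<sigma> s \<and>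
           (gmin ?\<sigma> s = 0 \<longrightarrow> gmin ?\<sigma> k = 0 \<and> c = 0))"
    proof
      fix s assume "s \<in> OPEN \<sigma> \<union> CLOSED \<sigma> - {initial_state P}"
      then show "\<exists>k\<in>CLOSED ?\<sigma>. parent ?\<sigma> s = Some k \<and>
        (\<forall>c\<in>edge_costs \<Sigma> (k, s). gmax ?\<sigma> k + c \<le> gmax ?\<sigma> s \<and>
           (gmin ?\<sigma> s = 0 \<longrightarrow> gmin ?\<sigma> k = 0 \<and> c = 0))"
        using live_parent[OF assms(2), of s] by auto
    qed
    have g: "OPEN ?\<sigma> \<inter> CLOSED ?\<sigma> = {}" "CLOSED ?\<sigma> \<inter> goals P = {}" using Ld 1(2) by auto
    show ?thesis unfolding live_def a using b c d f g Ld by simp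
  qed
  \<comment> \<open>While \<open>n\<close> was open, every closed node had an f-value at most that
    of \<open>n\<close>.\<close>
  moreover have "\<And>k. k \<in> CLOSED ?\<sigma> \<Longrightarrow> fval ?\<sigma> k \<le> fval ?\<sigma> n" using Ld n by auto
  ultimately show ?thesis using live_process_successors[OF 1(5)] 1(3,4) by simp
qed

text \<open>As long as some open node has a finite heuristic value, the invariant carries over;
  otherwise all open nodes are dead ends, and this persists.\<close>

lemma live_or_dead:
  assumes "(asec_step P ord \<epsilon> hv)\<^sup>*\<^sup>* \<sigma>\<^sub>0 \<sigma>" "asec_initial P hv \<sigma>\<^sub>0"
  shows "live {} \<sigma> \<or> (\<forall>m\<in>OPEN \<sigma>. hv m = \<infinity>)"
  using assms
proof (induction rule: rtranclp_induct)
  case base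
  then show ?case using live_initial by blast
next
  case (step \<sigma> \<sigma>')
  then show ?case using live_step dead_step by blast
qed

section \<open>The lower bound: no plan beats the selected node\<close>

lemma heuristic_le_plan_cost:
  assumes "exec \<Sigma> s \<pi> = Some g" "g \<in> goals P"
  shows "hv s \<le> plan_cost \<Sigma> \<pi>"
  using assms
proof (induction \<pi> arbitrary: s)
  case Nil
  then show ?case by (simp add: plan_cost_def hv_goal)
next
  case (Cons a \<pi>)
  then obtain t where t: "applicable \<Sigma> s a" "trans \<Sigma> s a = Some t" "exec \<Sigma> t \<pi> = Some g"
    by (auto simp: applicable_def split: if_splits)
  have "hv s \<le> \<alpha> (s, t) + hv t" using applicable_edge t hv_consistent by blast
  \<comment> \<open>Consistency with respect to \<open>\<alpha>\<close> yields admissibility for the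
    true costs, since \<open>\<alpha>\<close> underestimates them.\<close>
  also have "\<dots> \<le> acost \<Sigma> a + plan_cost \<Sigma> \<pi>"
    using Cons.IH[OF t(3)] Cons.prems applicable_edge[OF t(1,2)] first_lower_bound_bounds(2)
    by (intro add_mono) auto
  finally show ?case by (simp add: plan_cost_def)
qed

text \<open>Follow the plan from \<open>s\<close>. At an open node, minimality of \<open>n\<close>
  and admissibility finish; at a closed one, the next state is known with a lower bound at most the
  prefix cost. An open node is always met, as goals are never closed.\<close>

lemma min_open_le_plan_cost:
  assumes L: "live {} \<sigma>" and n: "min_open \<sigma> n"
    and "s \<in> OPEN \<sigma> \<union> CLOSED \<sigma>" "exec \<Sigma> s \<pi> = Some g" "g \<in> goals P"
  shows "fval \<sigma> n \<le> gmin \<sigma> s + plan_cost \<Sigma> \<pi>"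
  using assms(3-)
proof (induction \<pi> arbitrary: s)
  case Nil
  then have "s \<in> OPEN \<sigma>" using L unfolding live_def by auto
  then show ?case using n Nil L hv_goal
    by (auto simp: min_open_def live_def plan_cost_def)
next
  case (Cons a \<pi>)
  note Ld = L[unfolded live_def]
  show ?case
  proof (cases "s \<in> OPEN \<sigma>")
    case True
    then have "fval \<sigma> n \<le> gmin \<sigma> s + hv s" using n Ld by (auto simp: min_open_def)
    also have "\<dots> \<le> gmin \<sigma> s + plan_cost \<Sigma> (a # \<pi>)"
      using heuristic_le_plan_cost Cons.prems by (intro add_left_mono) blast
    finally show ?thesis .
  next
    case False
    then have s: "s \<in> CLOSED \<sigma>" using Cons by blast
    obtain t where t: "applicable \<Sigma> s a" "trans \<Sigma> s a = Some t" "exec \<Sigma> t \<pi> = Some g"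
      using Cons.prems by (auto simp: applicable_def split: if_splits)
    have st: "t \<in> OPEN \<sigma> \<union> CLOSED \<sigma>" "gmin \<sigma> t \<le> gmin \<sigma> s + acost \<Sigma> a"
      using Ld s applicable_edge[OF t(1,2)] by blast+
    have "fval \<sigma> n \<le> gmin \<sigma> t + plan_cost \<Sigma> \<pi>" using Cons.IH st t Cons.prems by blast
    also have "\<dots> \<le> (gmin \<sigma> s + acost \<Sigma> a) + plan_cost \<Sigma> \<pi>" using st by (intro add_right_mono)
    finally show ?thesis by (simp add: plan_cost_def add.assoc)
  qed
qed

section \<open>The upper bound along the traced plan\<close>

lemma exec_snoc:
  assumes "exec \<Sigma> s \<pi> = Some n" "applicable \<Sigma> n a" "trans \<Sigma> n a = Some t"
  shows "exec \<Sigma> s (\<pi> @ [a]) = Some t"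
  using assms by (induction \<pi> arbitrary: s) (auto split: if_splits)

text \<open>Add up the inequalities of \<open>live_parent\<close> along the parents. They hold for
  every cost in \<open>edge_costs\<close>, so any choice among parallel actions is covered.\<close>

lemma traced_plan_bounds:
  assumes "traced_plan P (parent \<sigma>) s \<pi>" "live {} \<sigma>" "s \<in> OPEN \<sigma> \<union> CLOSED \<sigma>"
  shows "exec \<Sigma> (initial_state P) \<pi> = Some s \<and> plan_cost \<Sigma> \<pi> \<le> gmax \<sigma> s \<and>
    (gmin \<sigma> s = 0 \<longrightarrow> plan_cost \<Sigma> \<pi> = 0)"
  using assms
proof (induction rule: traced_plan.induct)
  case start
  then show ?case by (simp add: live_def plan_cost_def)
next
  case (extend s n \<pi> a)
  have c: "acost \<Sigma> a \<in> edge_costs \<Sigma> (n, s)" using applicable_edge extend by blast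
  obtain n' where "n' \<in> CLOSED \<sigma>" "parent \<sigma> s = Some n'"
    and "\<forall>c\<in>edge_costs \<Sigma> (n', s). gmax \<sigma> n' + c \<le> gmax \<sigma> s \<and>
      (gmin \<sigma> s = 0 \<longrightarrow> gmin \<sigma> n' = 0 \<and> c = 0)"
    using live_parent[OF extend.prems(1), of s] extend.prems(2) extend.hyps(1) by blast
  then have n: "n \<in> CLOSED \<sigma>" "gmax \<sigma> n + acost \<Sigma> a \<le> gmax \<sigma> s"
    "gmin \<sigma> s = 0 \<longrightarrow> gmin \<sigma> n = 0 \<and> acost \<Sigma> a = 0"
    using extend.hyps(2) c by auto
  then have IH: "exec \<Sigma> (initial_state P) \<pi> = Some n" "plan_cost \<Sigma> \<pi> \<le> gmax \<sigma> n"
    "gmin \<sigma> n = 0 \<longrightarrow> plan_cost \<Sigma> \<pi> = 0"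
    using extend.IH[OF extend.prems(1)] by auto
  have "plan_cost \<Sigma> \<pi> + acost \<Sigma> a \<le> gmax \<sigma> s"
    using add_right_mono[OF IH(2)] n(2) order.trans by blast
  then show ?case using IH n(3) exec_snoc[OF IH(1) extend.hyps(4,5)] by (simp add: plan_cost_def)
qed

section \<open>Soundness of the returned plan\<close>

lemma optimal_cost_nonneg: "0 \<le> optimal_cost P"
proof -
  have "0 \<le> plan_cost \<Sigma> \<pi>" if "exec \<Sigma> s \<pi> = Some g" for s \<pi> g
    using that
  proof (induction \<pi> arbitrary: s)
    case (Cons a \<pi>)
    then have "0 \<le> acost \<Sigma> a" "0 \<le> plan_cost \<Sigma> \<pi>"
      using wf by (auto simp: wf_problem_def wf_domain_def applicable_def split: if_splits)
    then show ?case by (simp add: plan_cost_def)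
  qed (simp add: plan_cost_def)
  then show ?thesis by (auto simp: optimal_cost_def is_solution_def intro!: INF_greatest)
qed

lemma found_plan_sound:
  assumes L: "live {} \<sigma>" and n: "min_open \<sigma> n" "n \<in> goals P"
    and \<pi>: "traced_plan P (parent \<sigma>) n \<pi>"
    and \<epsilon>: "1 \<le> \<epsilon>" and \<eta>: "bound_ratio (gmax \<sigma> n) (gmin \<sigma> n) \<le> ereal \<epsilon>"
  shows "is_solution P \<pi> \<and> plan_cost \<Sigma> \<pi> \<le> ereal \<epsilon> * optimal_cost P"
proof -
  note Ld = L[unfolded live_def]
  have nO: "n \<in> OPEN \<sigma>" using n by (simp add: min_open_def)
  have T: "exec \<Sigma> (initial_state P) \<pi> = Some n" "plan_cost \<Sigma> \<pi> \<le> gmax \<sigma> n"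
    "gmin \<sigma> n = 0 \<Longrightarrow> plan_cost \<Sigma> \<pi> = 0"
    using traced_plan_bounds[OF \<pi> L] nO by auto
  have f: "fval \<sigma> n = gmin \<sigma> n" and g: "0 \<le> gmin \<sigma> n" "gmin \<sigma> n < \<infinity>"
    using Ld nO n(2) hv_goal by auto
  have opt: "gmin \<sigma> n \<le> optimal_cost P"
    \<comment> \<open>At a goal the heuristic vanishes, so the f-value of \<open>n\<close> is
      \<open>gmin \<sigma> n\<close>; the previous argument is applied at the initial state, where
      \<open>gmin\<close> is 0.\<close>
    unfolding optimal_cost_def is_solution_def
  proof (rule INF_greatest, clarify)
    fix \<pi>' s assume "s \<in> goals P" "exec \<Sigma> (initial_state P) \<pi>' = Some s"
    then show "gmin \<sigma> n \<le> plan_cost \<Sigma> \<pi>'"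
      using min_open_le_plan_cost[OF L n(1), of "initial_state P"] Ld f by simp
  qed
  have "plan_cost \<Sigma> \<pi> \<le> ereal \<epsilon> * optimal_cost P"
  proof (cases "gmin \<sigma> n = 0")
    case True
    \<comment> \<open>The ratio is 1 by convention here and bounds nothing; instead the traced plan
      has true cost 0.\<close>
    then show ?thesis using T(3) optimal_cost_nonneg \<epsilon> by simp
  next
    case False
    then obtain r where r: "gmin \<sigma> n = ereal r" "0 < r" using g by (cases "gmin \<sigma> n") auto
    have "gmax \<sigma> n \<le> ereal \<epsilon> * gmin \<sigma> n"
      using \<eta> r by (cases "gmax \<sigma> n") (auto simp: bound_ratio_def pos_divide_le_eq)
    also have "\<dots> \<le> ereal \<epsilon> * optimal_cost P" using opt \<epsilon> by (intro ereal_mult_left_mono) auto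
    finally show ?thesis using T(2) order.trans by blast
  qed
  then show ?thesis using T(1) n(2) by (auto simp: is_solution_def)
qed

end

theorem theorem3:
  fixes P :: "('s, 'a, 't) planning_problem"
    and ord :: "'s \<times> 's \<Rightarrow> 't list"
    and h :: "'s heuristic"
    and \<epsilon> :: real
    and \<pi> :: "'a list"
    and \<eta> :: ereal
  assumes "wf_problem P"
    and "estimator_order P ord"
    and "wf_heuristic (problem_domain P) h"
    and "consistent (problem_domain P) (goals P) h"
    and "1 \<le> \<epsilon>"
    and "asec P ord h \<epsilon> (Some \<pi>, \<eta>)"
    and "\<eta> \<le> ereal \<epsilon>"
  shows "is_solution P \<pi> \<and> plan_cost (problem_domain P) \<pi> \<le> ereal \<epsilon> * optimal_cost P"
proof -
  let ?\<Sigma> = "problem_domain P" and ?\<alpha> = "first_lower_bound P ord"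
  interpret estimation_problem P ord \<epsilon> using assms(1,2) by unfold_locales
  \<comment> \<open>Both assumptions on \<open>h\<close> speak only of edge cost functions; this
    licenses their use at \<open>?\<alpha>\<close>.\<close>
  have "edge_cost_function ?\<Sigma> ?\<alpha>"
    using first_lower_bound_bounds by (simp add: edge_cost_function_def)
  then interpret asec_run P ord \<epsilon> "h ?\<alpha>"
    using assms(3,4) by unfold_locales (auto simp: wf_heuristic_def consistent_def)
  from assms(6) show ?thesis
  proof cases
    case (found hv \<sigma>\<^sub>0 \<sigma> n)
    \<comment> \<open>The selected goal is an open node with finite heuristic value, which rules out
      the dead alternative of \<open>live_or_dead\<close>.\<close>
    have "h ?\<alpha> n = 0" "n \<in> OPEN \<sigma>" using found hv_goal by (auto simp: min_open_def)
    then have "live {} \<sigma>" using live_or_dead[of \<sigma>\<^sub>0 \<sigma>] found by force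
    then show ?thesis using found_plan_sound found assms(5,7) by blast
  qed
qed

end
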